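(* Let $n$ and $d$ be positive integers with $d\le n$, and let $C'$ be an $(n,M,d)$ permutation array. Then $$P(n,d)\ \ge\ \frac{n!\,M}{|\mathbf{B}(C')|}.$$
   Context: $S_n$ is the group of permutations of $Z_n=\{0,1,\ldots,n-1\}$. The Hamming distance $d(\mathbf{x},\mathbf{y})$ of $\mathbf{x},\mathbf{y}\in S_n$ is the number of $i\in Z_n$ with $\mathbf{x}(i)\neq\mathbf{y}(i)$. An $(n,d)$ permutation array (PA) is a subset $C\subseteq S_n$ in which any two distinct elements have distance at least $d$; an $(n,M,d)$ PA is an $(n,d)$ PA of size $M$; $P(n,d)$ is the maximum size of an $(n,d)$ PA. For an $(n,d)$ PA $C$, the covered ball is $\mathbf{B}(C)=\{\mathbf{a}\in S_n : d(\mathbf{a},\mathbf{c})<d \text{ for some } \mathbf{c}\in C\}$. *)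

theory Defs
  imports Complex_Main "HOL-Combinatorics.Permutations"
begin

text \<open>Permutations of \<open>Z\<^sub>n = {0, \<dots>, n - 1}\<close> are represented as functions on all of
  \<^typ>\<open>nat\<close> that fix every point outside \<open>{..<n}\<close>, so equality of functions is
  equality of permutations.\<close>

definition Sym :: "nat \<Rightarrow> (nat \<Rightarrow> nat) set" where
  "Sym n = {x. x permutes {..<n}}"

definition hamming_dist :: "nat \<Rightarrow> (nat \<Rightarrow> nat) \<Rightarrow> (nat \<Rightarrow> nat) \<Rightarrow> nat" where
  "hamming_dist n x y = card {i \<in> {..<n}. x i \<noteq> y i}"

definition perm_array :: "nat \<Rightarrow> nat \<Rightarrow> (nat \<Rightarrow> nat) set \<Rightarrow> bool" where
  "perm_array n d C \<longleftrightarrow>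
     C \<subseteq> Sym n \<and> (\<forall>x\<in>C. \<forall>y\<in>C. x \<noteq> y \<longrightarrow> d \<le> hamming_dist n x y)"

definition perm_array_of_size :: "nat \<Rightarrow> nat \<Rightarrow> nat \<Rightarrow> (nat \<Rightarrow> nat) set \<Rightarrow> bool" where
  "perm_array_of_size n M d C \<longleftrightarrow> perm_array n d C \<and> card C = M"

definition max_perm_array :: "nat \<Rightarrow> nat \<Rightarrow> nat" where
  "max_perm_array n d = Max {card C | C. perm_array n d C}"

definition covered_ball :: "nat \<Rightarrow> nat \<Rightarrow> (nat \<Rightarrow> nat) set \<Rightarrow> (nat \<Rightarrow> nat) set" where
  "covered_ball n d C = {a \<in> Sym n. \<exists>c\<in>C. hamming_dist n a c < d}"

lemma finite_Sym: "finite (Sym n)"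
  unfolding Sym_def by (rule finite_permutations) simp

text \<open>The set of sizes is finite and nonempty, so the \<^const>\<open>Max\<close> above is a genuine maximum.\<close>

lemma finite_perm_array_sizes: "finite {card C | C. perm_array n d C}"
proof -
  have "{card C | C. perm_array n d C} \<subseteq> card ` Pow (Sym n)"
    by (auto simp: perm_array_def)
  then show ?thesis
    by (rule finite_subset) (simp add: finite_Sym)
qed

lemma perm_array_sizes_nonempty: "{card C | C. perm_array n d C} \<noteq> {}"
proof -
  have "perm_array n d {}"
    by (simp add: perm_array_def)
  then show ?thesis
    by blast
qed

end

theory Submission
  imports Defs
begin

text \<open>Let \<open>C\<close> be a permutation array of maximum size. For every \<open>g\<close> in \<open>S\<^sub>n\<close> the left
  translate \<open>gC\<close> is again a permutation array, and replacing its part inside \<open>B(C')\<close> by \<open>C'\<close>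
  gives another one; by maximality \<open>gC\<close> meets \<open>B(C')\<close> in at least \<open>M\<close> points. Summing
  over all \<open>g\<close> and counting pairs \<open>(g, c)\<close> with \<open>gc\<close> in \<open>B(C')\<close> the other way
  round gives \<open>n! M \<le> |C| |B(C')|\<close>.\<close>

lemma hamming_dist_commute: "hamming_dist n x y = hamming_dist n y x"
  unfolding hamming_dist_def by (rule arg_cong[where f = card]) auto

lemma hamming_dist_self [simp]: "hamming_dist n x x = 0"
  by (simp add: hamming_dist_def)

lemma hamming_dist_comp_left:
  assumes "inj g"
  shows "hamming_dist n (g \<circ> x) (g \<circ> y) = hamming_dist n x y"
  using assms by (simp add: hamming_dist_def inj_eq)

lemma perm_array_finite: "perm_array n d C \<Longrightarrow> finite C"
  by (rule finite_subset[OF _ finite_Sym[of n]]) (simp add: perm_array_def)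

lemma card_le_max_perm_array: "perm_array n d C \<Longrightarrow> card C \<le> max_perm_array n d"
  unfolding max_perm_array_def by (rule Max_ge[OF finite_perm_array_sizes]) blast

lemma max_perm_array_attained:
  obtains C where "perm_array n d C" "card C = max_perm_array n d"
  using Max_in[OF finite_perm_array_sizes perm_array_sizes_nonempty, of n d]
  unfolding max_perm_array_def by auto

lemma Sym_inj: "g \<in> Sym n \<Longrightarrow> inj g"
  by (simp add: Sym_def permutes_inj)

lemma perm_array_translate:
  assumes "g \<in> Sym n" and "perm_array n d C"
  shows "perm_array n d ((\<circ>) g ` C)"
proof -
  have "(\<circ>) g ` C \<subseteq> Sym n"
    using assms by (auto simp: perm_array_def Sym_def intro!: permutes_compose)
  then show ?thesis
    using assms by (auto simp: perm_array_def hamming_dist_comp_left[OF Sym_inj])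
qed

lemma inj_on_comp_left: "inj g \<Longrightarrow> inj_on ((\<circ>) g) A"
  by (rule inj_onI) (simp add: fun_eq_iff inj_eq)

text \<open>Only pairs with one element from each side are new, and removing the covered ball from
  \<open>C\<close> leaves exactly the elements at distance at least \<open>d\<close> from all of
  \<open>C'\<close>.\<close>

lemma perm_array_replace:
  assumes "perm_array n d C" and "perm_array n d C'"
  shows "perm_array n d ((C - covered_ball n d C') \<union> C')"
proof -
  have far: "d \<le> hamming_dist n a c" if "a \<in> C - covered_ball n d C'" "c \<in> C'" for a c
  proof -
    have "a \<in> Sym n"
      using that(1) assms(1) unfolding perm_array_def by blast
    then show ?thesis
      using that unfolding covered_ball_def by (simp add: not_less)
  qed
  \<comment> \<open>\<open>perm_array\<close> quantifies over ordered pairs, so the mixed case is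
    needed in both orders.\<close>
  then have "d \<le> hamming_dist n c a" if "a \<in> C - covered_ball n d C'" "c \<in> C'" for a c
    using that by (metis hamming_dist_commute)
  moreover have "C - covered_ball n d C' \<union> C' \<subseteq> Sym n"
    using assms by (auto simp: perm_array_def)
  ultimately show ?thesis
    using far assms unfolding perm_array_def by (simp only: ball_Un) simp
qed

lemma subset_covered_ball:
  assumes "0 < d" and "perm_array n d C'"
  shows "C' \<subseteq> covered_ball n d C'"
proof
  fix c assume "c \<in> C'"
  with assms show "c \<in> covered_ball n d C'"
    unfolding covered_ball_def perm_array_def by force
qed

text \<open>Exchange argument: the array obtained by replacement has
  \<open>card (C - ?B) + card C'\<close> elements, at most \<open>card C\<close> by maximality;
  cancelling \<open>card (C - ?B)\<close> leaves the claim. The union is disjoint because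
  \<open>C'\<close> lies inside its ball, which uses \<open>0 < d\<close>.\<close>

lemma card_le_card_Int_covered_ball:
  assumes "0 < d" and C: "perm_array n d C" "card C = max_perm_array n d"
    and C': "perm_array n d C'"
  shows "card C' \<le> card (C \<inter> covered_ball n d C')"
proof -
  let ?B = "covered_ball n d C'"
  have fin: "finite C" "finite C'"
    using C C' perm_array_finite by auto
  have "card (C - ?B) + card C' = card ((C - ?B) \<union> C')"
    using fin subset_covered_ball[OF assms(1) C'] by (intro card_Un_disjoint[symmetric]) auto
  also have "\<dots> \<le> card C"
    using card_le_max_perm_array[OF perm_array_replace[OF C(1) C']] C(2) by simp
  also have "card C = card (C - ?B) + card (C \<inter> ?B)"
    using card_Int_Diff[OF fin(1), of ?B] by simp
  finally show ?thesis
    by simp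
qed

lemma card_Sym: "card (Sym n) = fact n"
  unfolding Sym_def by (simp add: card_permutations)

lemma fact_mult_card_le:
  assumes "0 < d" and C': "perm_array n d C'"
  shows "fact n * card C' \<le> max_perm_array n d * card (covered_ball n d C')"
proof -
  let ?B = "covered_ball n d C'"
  have finB: "finite ?B"
    using finite_Sym[of n] by (simp add: covered_ball_def)
  obtain C where C: "perm_array n d C" "card C = max_perm_array n d"
    by (rule max_perm_array_attained)
  have finC: "finite C"
    using C(1) by (rule perm_array_finite)
  have translate: "card C' \<le> card {c \<in> C. g \<circ> c \<in> ?B}" if g: "g \<in> Sym n" for g
  proof -
    have inj: "inj_on ((\<circ>) g) A" for A :: "(nat \<Rightarrow> nat) set"
      using Sym_inj[OF g] by (rule inj_on_comp_left)
    \<comment> \<open>Left composition with \<open>g\<close> is injective, so the translate also has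
      maximum size and the exchange argument applies to it.\<close>
    have "card C' \<le> card ((\<circ>) g ` C \<inter> ?B)"
      using perm_array_translate[OF g C(1)] C(2) assms
      by (intro card_le_card_Int_covered_ball) (auto simp: card_image inj)
    also have "(\<circ>) g ` C \<inter> ?B = (\<circ>) g ` {c \<in> C. g \<circ> c \<in> ?B}"
      by auto
    finally show ?thesis
      by (simp add: card_image inj)
  qed
  \<comment> \<open>As \<open>c\<close> is surjective, \<open>g\<close> can be recovered from
    \<open>g \<circ> c\<close>, so right composition with \<open>c\<close> embeds this set into the
    ball.\<close>
  have fibre: "card {g \<in> Sym n. g \<circ> c \<in> ?B} \<le> card ?B" if "c \<in> C" for c
  proof (rule card_inj_on_le[OF _ _ finB])
    have "surj c"
      using permutes_surj[of c "{..<n}"] that C(1) by (auto simp: perm_array_def Sym_def)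
    then show "inj_on (\<lambda>g. g \<circ> c) {g \<in> Sym n. g \<circ> c \<in> ?B}"
      by (auto simp: inj_on_def intro: surj_fun_eq)
  qed auto
  have "fact n * card C' = (\<Sum>g\<in>Sym n. card C')"
    by (simp add: card_Sym)
  also have "\<dots> \<le> (\<Sum>g\<in>Sym n. card {c \<in> C. g \<circ> c \<in> ?B})"
    by (intro sum_mono translate)
  \<comment> \<open>Double counting: both cardinalities are sums of ones over the pairs with
    \<open>g \<circ> c\<close> in the ball, and the order of summation is swapped.\<close>
  also have "\<dots> = (\<Sum>c\<in>C. card {g \<in> Sym n. g \<circ> c \<in> ?B})"
    using sum.swap_restrict[OF finite_Sym[of n] finC, of "\<lambda>_ _. 1::nat" "\<lambda>g c. g \<circ> c \<in> ?B"]
    by simp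
  also have "\<dots> \<le> (\<Sum>c\<in>C. card ?B)"
    by (intro sum_mono fibre)
  finally show ?thesis
    by (simp add: C(2))
qed

theorem theorem6:
  fixes n d M :: nat and C' :: "(nat \<Rightarrow> nat) set"
  assumes "0 < n" and "0 < d" and "d \<le> n"
    and "perm_array_of_size n M d C'"
  shows "real (max_perm_array n d) \<ge> fact n * real M / real (card (covered_ball n d C'))"
proof -
  have C': "perm_array n d C'" "card C' = M"
    using assms(4) by (auto simp: perm_array_of_size_def)
  have "real (fact n * M) \<le> real (max_perm_array n d * card (covered_ball n d C'))"
    using fact_mult_card_le[OF assms(2) C'(1)] C'(2) by (simp only: of_nat_le_iff)
  then have "fact n * real M \<le> real (max_perm_array n d) * real (card (covered_ball n d C'))"
    by simp
  then show ?thesis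
    \<comment> \<open>An empty \<open>C'\<close> has an empty ball; division by zero yields 0, so
      the bound is then trivial.\<close>
    by (cases "card (covered_ball n d C') = 0") (simp_all add: divide_le_eq)
qed

end
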